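(* Let $\phi\in\{\text{EF},\text{EF1},\text{EFX}\}$ and let $\mathcal{I}=(N,A,V)$ be an instance of $\phi$-Fair Division with Externalities. Assume that for every agent $i\in N$ there exist two numbers $x_i$ and $y_i$ such that $V_i(j,a)\in\{x_i,y_i\}$ for every agent $j\in N$ and every item $a\in A$. Then $\mathcal{I}$ can be transformed in linear time into an equivalent instance $\mathcal{I}'=(N,A,V')$ of $\phi$-Fair Division with Externalities with the same sets of agents and items and with binary valuations (i.e. $V'_i(j,a)\in\{0,1\}$ for all $i,j\in N$, $a\in A$). Here equivalent means that an allocation of $A$ to $N$ satisfies $\phi$ in $\mathcal{I}$ if and only if it satisfies $\phi$ in $\mathcal{I}'$.
   Context: An instance $(N,A,V)$ of Fair Division with Externalities consists of a set of agents $N=\{1,\dots,n\}$, a set of indivisible items $A=\{a_1,\dots,a_m\}$, and for all agents $i,j\in N$ and every item $a\in A$ a number $V_i(j,a)$: the value agent $i$ gets if item $a$ is allocated to agent $j$ (here $j=i$ is allowed). The task in $\phi$-Fair Division with Externalities is to decide whether there is an allocation satisfying $\phi$. An allocation of a set of items is a partition $\pi=(\pi_1,\dots,\pi_n)$ of that set into $n$ possibly empty bundles, $\pi_i$ being given to agent $i$; $\pi(a)$ denotes the agent receiving $a$. The value of $\pi$ for agent $i$ is $V_i(\pi)=\sum_a V_i(\pi(a),a)$, the sum ranging over the items allocated by $\pi$. $\pi^{i\leftrightarrow j}$ denotes the allocation obtained from $\pi$ by swapping the bundles of agents $i$ and $j$ and leaving the other bundles unchanged. An allocation $\pi$ of $A$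 is: - envy-free (EF) if $V_i(\pi)\ge V_i(\pi^{i\leftrightarrow j})$ for every pair of agents $i,j\in N$; - envy-free up to one item (EF1) if for every pair of agents $i,j\in N$ there is an item $a\in A$ such that the allocation $\lambda$ (of $A\setminus\{a\}$) with $\lambda_\ell=\pi_\ell\setminus\{a\}$ for all $\ell\in N$ satisfies $V_i(\lambda)\ge V_i(\lambda^{i\leftrightarrow j})$; - envy-free up to any item (EFX) if for every pair of agents $i,j\in N$ with $V_i(\pi)<V_i(\pi^{i\leftrightarrow j})$ the following holds: for any item $a\in A$ and the allocation $\lambda$ with $\lambda_\ell=\pi_\ell\setminus\{a\}$ for all $\ell\in N$, if $V_i(\lambda)-V_i(\lambda^{i\leftrightarrow j})>V_i(\pi)-V_i(\pi^{i\leftrightarrow j})$, then $V_i(\lambda)\ge V_i(\lambda^{i\leftrightarrow j})$. *)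

theory Defs
  imports Complex_Main "HOL-Library.Disjoint_Sets"
begin

section \<open>Fair division with externalities\<close>

text \<open>The item $a_k$ is represented by its index $k$. The number \<open>val I i j a\<close> is $V_i(j,a)$; it is
  only relevant for agents \<open>i\<close>, \<open>j\<close> and items \<open>a\<close> of the instance.\<close>

record inst =
  num_agents :: nat
  num_items :: nat
  val :: "nat \<Rightarrow> nat \<Rightarrow> nat \<Rightarrow> real"

definition agents :: "inst \<Rightarrow> nat set" where
  "agents I = {1..num_agents I}"

definition items :: "inst \<Rightarrow> nat set" where
  "items I = {1..num_items I}"

type_synonym bundles = "nat \<Rightarrow> nat set"

definition allocation :: "inst \<Rightarrow> nat set \<Rightarrow> bundles \<Rightarrow> bool" where
  "allocation I S \<pi> \<longleftrightarrow> (\<Union>i\<in>agents I. \<pi> i) = S \<and> disjoint_family_on \<pi> (agents I)"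

definition receiver :: "inst \<Rightarrow> bundles \<Rightarrow> nat \<Rightarrow> nat" where
  "receiver I \<pi> a = (THE i. i \<in> agents I \<and> a \<in> \<pi> i)"

definition alloc_val :: "inst \<Rightarrow> nat \<Rightarrow> bundles \<Rightarrow> real" where
  "alloc_val I i \<pi> = (\<Sum>a\<in>(\<Union>l\<in>agents I. \<pi> l). val I i (receiver I \<pi> a) a)"

definition swap :: "nat \<Rightarrow> nat \<Rightarrow> bundles \<Rightarrow> bundles" where
  "swap i j \<pi> = \<pi>(i := \<pi> j, j := \<pi> i)"

definition remove_item :: "nat \<Rightarrow> bundles \<Rightarrow> bundles" where
  "remove_item a \<pi> = (\<lambda>l. \<pi> l - {a})"

definition envy_free :: "inst \<Rightarrow> bundles \<Rightarrow> bool" where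
  "envy_free I \<pi> \<longleftrightarrow>
     (\<forall>i\<in>agents I. \<forall>j\<in>agents I. alloc_val I i \<pi> \<ge> alloc_val I i (swap i j \<pi>))"

definition envy_free_up_to_one :: "inst \<Rightarrow> bundles \<Rightarrow> bool" where
  "envy_free_up_to_one I \<pi> \<longleftrightarrow>
     (\<forall>i\<in>agents I. \<forall>j\<in>agents I. \<exists>a\<in>items I.
        let \<mu> = remove_item a \<pi> in alloc_val I i \<mu> \<ge> alloc_val I i (swap i j \<mu>))"

definition envy_free_up_to_any :: "inst \<Rightarrow> bundles \<Rightarrow> bool" where
  "envy_free_up_to_any I \<pi> \<longleftrightarrow>
     (\<forall>i\<in>agents I. \<forall>j\<in>agents I. alloc_val I i \<pi> < alloc_val I i (swap i j \<pi>) \<longrightarrow>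
        (\<forall>a\<in>items I. let \<mu> = remove_item a \<pi> in
           alloc_val I i \<mu> - alloc_val I i (swap i j \<mu>)
             > alloc_val I i \<pi> - alloc_val I i (swap i j \<pi>) \<longrightarrow>
           alloc_val I i \<mu> \<ge> alloc_val I i (swap i j \<mu>)))"

datatype fairness = EF | EF1 | EFX

fun satisfies :: "fairness \<Rightarrow> inst \<Rightarrow> bundles \<Rightarrow> bool" where
  "satisfies EF I \<pi> = envy_free I \<pi>"
| "satisfies EF1 I \<pi> = envy_free_up_to_one I \<pi>"
| "satisfies EFX I \<pi> = envy_free_up_to_any I \<pi>"

definition two_valued :: "inst \<Rightarrow> bool" where
  "two_valued I \<longleftrightarrow>
     (\<forall>i\<in>agents I. \<exists>x y. \<forall>j\<in>agents I. \<forall>a\<in>items I. val I i j a \<in> {x, y})"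

definition binary :: "inst \<Rightarrow> bool" where
  "binary I \<longleftrightarrow> (\<forall>i\<in>agents I. \<forall>j\<in>agents I. \<forall>a\<in>items I. val I i j a \<in> {0, 1})"

text \<open>Meant for instances with the same agents and items, so that the two sides of the equivalence
  range over the same allocations.\<close>

definition equivalent_inst :: "fairness \<Rightarrow> inst \<Rightarrow> inst \<Rightarrow> bool" where
  "equivalent_inst \<phi> I I' \<longleftrightarrow>
     (\<forall>\<pi>. allocation I (items I) \<pi> \<longrightarrow> (satisfies \<phi> I \<pi> \<longleftrightarrow> satisfies \<phi> I' \<pi>))"


section \<open>Running time\<close>

text \<open>Running time is measured on a uniform-cost random access machine, programmed with structured
  control flow. It has index registers holding natural numbers and a memory of cells holding real
  numbers; a cell is addressed indirectly, by the content of an index register. Every elementary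
  operation, including each evaluation of a test, takes one step. Indices can only be added,
  subtracted and compared; real numbers can only be copied and compared, and integer constants can
  be written to a cell. In particular there is no unit-cost multiplication and no unit-cost
  arithmetic on reals. A program is a finite syntactic object, so a single program has to handle
  instances of all sizes.\<close>

record state =
  reg :: "nat \<Rightarrow> nat"
  mem :: "nat \<Rightarrow> real"

datatype test =
    RegLess nat nat
  | MemLess nat nat

datatype prog =
    Skip
  | RegConst nat nat
  | RegAdd nat nat nat
  | RegSub nat nat nat
  | MemConst nat int
  | MemCopy nat nat
  | Seq prog prog
  | Cond test prog prog
  | While test prog

fun holds :: "test \<Rightarrow> state \<Rightarrow> bool" where
  "holds (RegLess r q) s \<longleftrightarrow> reg s r < reg s q"
| "holds (MemLess r q) s \<longleftrightarrow> mem s (reg s r) < mem s (reg s q)"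

text \<open>\<open>exec p s t s'\<close>: started in \<open>s\<close>, the program \<open>p\<close> halts in \<open>s'\<close> after exactly \<open>t\<close> steps.\<close>

inductive exec :: "prog \<Rightarrow> state \<Rightarrow> nat \<Rightarrow> state \<Rightarrow> bool" where
  Skip: "exec Skip s 1 s"
| RegConst: "exec (RegConst r k) s 1 (s\<lparr>reg := (reg s)(r := k)\<rparr>)"
| RegAdd: "exec (RegAdd r p q) s 1 (s\<lparr>reg := (reg s)(r := reg s p + reg s q)\<rparr>)"
| RegSub: "exec (RegSub r p q) s 1 (s\<lparr>reg := (reg s)(r := reg s p - reg s q)\<rparr>)"
| MemConst: "exec (MemConst r k) s 1 (s\<lparr>mem := (mem s)(reg s r := of_int k)\<rparr>)"
| MemCopy: "exec (MemCopy r q) s 1 (s\<lparr>mem := (mem s)(reg s r := mem s (reg s q))\<rparr>)"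
| Seq: "\<lbrakk>exec p s t s'; exec q s' t' s''\<rbrakk> \<Longrightarrow> exec (Seq p q) s (t + t') s''"
| CondTrue: "\<lbrakk>holds b s; exec p s t s'\<rbrakk> \<Longrightarrow> exec (Cond b p q) s (1 + t) s'"
| CondFalse: "\<lbrakk>\<not> holds b s; exec q s t s'\<rbrakk> \<Longrightarrow> exec (Cond b p q) s (1 + t) s'"
| WhileFalse: "\<not> holds b s \<Longrightarrow> exec (While b p) s 1 s"
| WhileTrue: "\<lbrakk>holds b s; exec p s t s'; exec (While b p) s' t' s''\<rbrakk>
    \<Longrightarrow> exec (While b p) s (1 + t + t') s''"

inductive_cases exec_SkipE: "exec Skip s t s'"
inductive_cases exec_RegConstE: "exec (RegConst r k) s t s'"
inductive_cases exec_RegAddE: "exec (RegAdd r p q) s t s'"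
inductive_cases exec_RegSubE: "exec (RegSub r p q) s t s'"
inductive_cases exec_MemConstE: "exec (MemConst r k) s t s'"
inductive_cases exec_MemCopyE: "exec (MemCopy r q) s t s'"
inductive_cases exec_SeqE: "exec (Seq p q) s t s'"
inductive_cases exec_CondE: "exec (Cond b p q) s t s'"
inductive_cases exec_WhileE: "exec (While b p) s t s'"

lemma exec_deterministic:
  "exec p s t s' \<Longrightarrow> exec p s u s'' \<Longrightarrow> u = t \<and> s'' = s'"
proof (induction arbitrary: u s'' rule: exec.induct)
  case (Seq p s t s' q t' s1)
  from Seq.prems show ?case
  proof (rule exec_SeqE)
    fix v r v'
    assume h: "u = v + v'" "exec p s v r" "exec q r v' s''"
    from Seq.IH(1)[OF h(2)] have "v = t" "r = s'" by simp_all
    with Seq.IH(2)[of v' s''] h show ?thesis by simp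
  qed
next
  case (CondTrue b s p t s' q)
  from CondTrue.prems show ?case
    by (rule exec_CondE) (use CondTrue.hyps(1) CondTrue.IH in simp_all)
next
  case (CondFalse b s q t s' p)
  from CondFalse.prems show ?case
    by (rule exec_CondE) (use CondFalse.hyps(1) CondFalse.IH in simp_all)
next
  case (WhileFalse b s p)
  from WhileFalse.prems show ?case
    by (rule exec_WhileE) (use WhileFalse.hyps in simp_all)
next
  case (WhileTrue b s p t s' t' s1)
  from WhileTrue.prems show ?case
  proof (rule exec_WhileE)
    assume "\<not> holds b s"
    with WhileTrue.hyps(1) show ?thesis by simp
  next
    fix v r v'
    assume h: "u = Suc (v + v')" "exec p s v r" "exec (While b p) r v' s''"
    from WhileTrue.IH(1)[OF h(2)] have "v = t" "r = s'" by simp_all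
    with WhileTrue.IH(2)[of v' s''] h show ?thesis by simp
  qed
qed (erule exec_SkipE exec_RegConstE exec_RegAddE exec_RegSubE exec_MemConstE exec_MemCopyE; simp)+

text \<open>The numbers of agents and items are kept in registers 0 and 1, and the valuations in the first
  cells of the memory, in lexicographic order of \<open>(i, j, a)\<close>. All other registers and cells are
  arbitrary. The input therefore consists of \<open>2 + num_agents I * num_agents I * num_items I\<close>
  numbers.\<close>

definition cell :: "inst \<Rightarrow> nat \<Rightarrow> nat \<Rightarrow> nat \<Rightarrow> nat" where
  "cell I i j a = ((i - 1) * num_agents I + (j - 1)) * num_items I + (a - 1)"

definition represents :: "state \<Rightarrow> inst \<Rightarrow> bool" where
  "represents s I \<longleftrightarrow> reg s 0 = num_agents I \<and> reg s 1 = num_items I \<and>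
     (\<forall>i\<in>agents I. \<forall>j\<in>agents I. \<forall>a\<in>items I. mem s (cell I i j a) = val I i j a)"

definition input_size :: "inst \<Rightarrow> nat" where
  "input_size I = 2 + num_agents I * num_agents I * num_items I"

end

theory Submission
  imports Defs
begin

text \<open>For each agent replace \<open>V\<^sub>i(j, a)\<close> by \<open>1\<close> if it exceeds the least value \<open>y\<^sub>i\<close> of the agent,
  and by \<open>0\<close> otherwise. Then \<open>V\<^sub>i = y\<^sub>i + d\<^sub>i V'\<^sub>i\<close> with \<open>d\<^sub>i > 0\<close>, and since an allocation and
  the one obtained by swapping two bundles allocate the same items, every difference of values that
  occurs in the three fairness notions is merely scaled by \<open>d\<^sub>i\<close>. The values of one agent are stored
  consecutively, so two scans of each block of the memory compute \<open>V'\<close> in place.\<close>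

section \<open>Positive affine changes of the valuations\<close>

lemma receiver_mem_agents:
  assumes "allocation I S \<pi>" "a \<in> S"
  shows "receiver I \<pi> a \<in> agents I"
proof -
  obtain l where l: "l \<in> agents I" "a \<in> \<pi> l"
    using assms unfolding allocation_def by blast
  have "l' = l" if "l' \<in> agents I \<and> a \<in> \<pi> l'" for l'
    using that l assms(1) unfolding allocation_def disjoint_family_on_def by blast
  with l have "receiver I \<pi> a = l"
    unfolding receiver_def by (intro the_equality) blast+
  with l show ?thesis by simp
qed

text \<open>Swapping is precomposition with a transposition of agents; a bijection of the index set
  preserves union and disjointness, also when \<open>i = j\<close>.\<close>

lemma allocation_swap:
  assumes "allocation I S \<pi>" "i \<in> agents I" "j \<in> agents I"
  shows "allocation I S (swap i j \<pi>)"
proof -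
  let ?f = "id(i := j, j := i)"
  have bij: "bij_betw ?f (agents I) (agents I)"
    using assms(2,3) by (intro bij_betwI[of _ _ _ ?f]) auto
  have swap: "swap i j \<pi> = \<pi> \<circ> ?f"
    by (simp add: swap_def fun_eq_iff)
  have "(\<Union>l\<in>agents I. swap i j \<pi> l) = (\<Union>l\<in>agents I. \<pi> l)"
    unfolding swap using bij_betw_imp_surj_on[OF bij] by (metis image_comp)
  moreover have "disjoint_family_on (swap i j \<pi>) (agents I)"
    unfolding disjoint_family_on_def swap comp_def
  proof (intro ballI impI)
    fix k l assume "k \<in> agents I" "l \<in> agents I" "k \<noteq> l"
    then have "?f k \<in> agents I" "?f l \<in> agents I" "?f k \<noteq> ?f l"
      using bij_betw_apply[OF bij] bij_betw_imp_inj_on[OF bij] by (blast dest: inj_onD)+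
    then show "\<pi> (?f k) \<inter> \<pi> (?f l) = {}"
      using assms(1) unfolding allocation_def disjoint_family_on_def by blast
  qed
  ultimately show ?thesis using assms(1) unfolding allocation_def by simp
qed

lemma allocation_remove_item:
  assumes "allocation I S \<pi>"
  shows "allocation I (S - {a}) (remove_item a \<pi>)"
  using assms unfolding allocation_def disjoint_family_on_def remove_item_def by blast

text \<open>Each item of \<open>S\<close> has one receiver among the agents, so the offset
  \<open>y\<close> is collected once per item whoever that is. Its total depends on \<open>S\<close>
  alone and cancels between allocations of the same set. The superset \<open>T\<close> lets this
  cover allocations with an item removed.\<close>

lemma alloc_val_affine:
  assumes agents: "agents I' = agents I" and alloc: "allocation I S \<pi>" and "S \<subseteq> T"
    and aff: "\<And>j a. j \<in> agents I \<Longrightarrow> a \<in> T \<Longrightarrow> val I i j a = y + d * val I' i j a"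
  shows "alloc_val I i \<pi> = real (card S) * y + d * alloc_val I' i \<pi>"
proof -
  have rec: "receiver I' \<pi> = receiver I \<pi>"
    by (simp add: receiver_def agents fun_eq_iff)
  have S: "(\<Union>l\<in>agents I. \<pi> l) = S"
    using alloc by (simp add: allocation_def)
  have "alloc_val I i \<pi> = (\<Sum>a\<in>S. y + d * val I' i (receiver I' \<pi> a) a)"
    unfolding alloc_val_def S rec
  proof (rule sum.cong)
    fix a assume "a \<in> S"
    then show "val I i (receiver I \<pi> a) a = y + d * val I' i (receiver I \<pi> a) a"
      using \<open>S \<subseteq> T\<close> by (intro aff receiver_mem_agents[OF alloc]) auto
  qed simp
  also have "\<dots> = real (card S) * y + d * alloc_val I' i \<pi>"
    by (simp add: alloc_val_def agents S sum.distrib sum_distrib_left)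
  finally show ?thesis .
qed

lemma equivalent_inst_affine:
  assumes eq: "num_agents I' = num_agents I" "num_items I' = num_items I"
    and aff: "\<And>i. i \<in> agents I \<Longrightarrow> \<exists>y d. d > 0 \<and>
      (\<forall>j\<in>agents I. \<forall>a\<in>items I. val I i j a = y + d * val I' i j a)"
  shows "equivalent_inst \<phi> I I'"
  unfolding equivalent_inst_def
proof (intro allI impI)
  fix \<pi> assume \<pi>: "allocation I (items I) \<pi>"
  have ag: "agents I' = agents I" and it: "items I' = items I"
    using eq by (simp_all add: agents_def items_def)
  define gap where "gap J \<mu> i j = alloc_val J i \<mu> - alloc_val J i (swap i j \<mu>)" for J \<mu> i j
  \<comment> \<open>The factor \<open>d\<close> is chosen before \<open>S\<close>,
    \<open>\<mu>\<close> and \<open>j\<close>: EFX compares the gap of an allocation with the gap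
    after removing an item, so both must scale alike.\<close>
  have "\<exists>d>0. \<forall>S \<mu> j. allocation I S \<mu> \<longrightarrow> S \<subseteq> items I \<longrightarrow> j \<in> agents I \<longrightarrow>
      gap I \<mu> i j = d * gap I' \<mu> i j" if i: "i \<in> agents I" for i
  proof -
    obtain y d where d: "d > 0"
      and *: "\<And>j a. j \<in> agents I \<Longrightarrow> a \<in> items I \<Longrightarrow> val I i j a = y + d * val I' i j a"
      using aff[OF i] by blast
    have "gap I \<mu> i j = d * gap I' \<mu> i j"
      if "allocation I S \<mu>" "S \<subseteq> items I" "j \<in> agents I" for S \<mu> j
      using alloc_val_affine[OF ag that(1,2) *]
        alloc_val_affine[OF ag allocation_swap[OF that(1) i that(3)] that(2) *]
      by (simp add: gap_def algebra_simps)
    with d show ?thesis by blast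
  qed
  then obtain d where d: "\<And>i. i \<in> agents I \<Longrightarrow> d i > 0"
    and gap: "\<And>i j S \<mu>. \<lbrakk>i \<in> agents I; j \<in> agents I; allocation I S \<mu>; S \<subseteq> items I\<rbrakk>
      \<Longrightarrow> gap I \<mu> i j = d i * gap I' \<mu> i j"
    by metis
  have scale: "gap I \<pi> i j = d i * gap I' \<pi> i j"
    "gap I (remove_item a \<pi>) i j = d i * gap I' (remove_item a \<pi>) i j"
    if "i \<in> agents I" "j \<in> agents I" for i j a
    using that gap[OF that \<pi>] gap[OF that allocation_remove_item[OF \<pi>]] by auto
  have le: "alloc_val J i (swap i j \<mu>) \<le> alloc_val J i \<mu> \<longleftrightarrow> 0 \<le> gap J \<mu> i j"
    and less: "alloc_val J i \<mu> < alloc_val J i (swap i j \<mu>) \<longleftrightarrow> gap J \<mu> i j < 0" for J i j \<mu>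
    by (auto simp: gap_def)
  have sign: "0 \<le> d i * x \<longleftrightarrow> 0 \<le> x" "d i * x < 0 \<longleftrightarrow> x < 0" "d i * x < d i * y \<longleftrightarrow> x < y"
    if "i \<in> agents I" for i and x y :: real
    using d[OF that] by (auto simp: zero_le_mult_iff mult_less_0_iff)
  have "satisfies EF I \<pi> \<longleftrightarrow> satisfies EF I' \<pi>"
    by (simp add: envy_free_def ag le scale sign)
  moreover have "satisfies EF1 I \<pi> \<longleftrightarrow> satisfies EF1 I' \<pi>"
    by (simp add: envy_free_up_to_one_def Let_def ag it le scale sign)
  \<comment> \<open>Differences are folded into \<open>gap\<close> first, since \<open>scale\<close>
    is stated for \<open>gap\<close>.\<close>
  moreover have "satisfies EFX I \<pi> \<longleftrightarrow> satisfies EFX I' \<pi>"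
    by (simp add: envy_free_up_to_any_def Let_def ag it le less flip: gap_def)
      (simp add: scale sign)
  ultimately show "satisfies \<phi> I \<pi> \<longleftrightarrow> satisfies \<phi> I' \<pi>"
    by (cases \<phi>) simp_all
qed

section \<open>Symbolic execution of programs\<close>

text \<open>Total correctness, with the step count passed to the postcondition. By determinism the
  run asked for is the only one.\<close>

definition wp :: "prog \<Rightarrow> state \<Rightarrow> (nat \<Rightarrow> state \<Rightarrow> bool) \<Rightarrow> bool" where
  "wp p s Q \<longleftrightarrow> (\<exists>t s'. exec p s t s' \<and> Q t s')"

lemma wp_mono: "wp p s Q \<Longrightarrow> (\<And>t s'. Q t s' \<Longrightarrow> R t s') \<Longrightarrow> wp p s R"
  by (auto simp: wp_def)

lemma wp_atomic [simp]:
  "wp Skip s Q \<longleftrightarrow> Q 1 s"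
  "wp (RegConst r k) s Q \<longleftrightarrow> Q 1 (s\<lparr>reg := (reg s)(r := k)\<rparr>)"
  "wp (RegAdd r p q) s Q \<longleftrightarrow> Q 1 (s\<lparr>reg := (reg s)(r := reg s p + reg s q)\<rparr>)"
  "wp (MemConst r c) s Q \<longleftrightarrow> Q 1 (s\<lparr>mem := (mem s)(reg s r := of_int c)\<rparr>)"
  "wp (MemCopy r q) s Q \<longleftrightarrow> Q 1 (s\<lparr>mem := (mem s)(reg s r := mem s (reg s q))\<rparr>)"
  unfolding wp_def by (metis exec.intros(1-6) exec_deterministic)+

lemma wp_Seq [simp]:
  "wp (Seq p q) s Q \<longleftrightarrow> wp p s (\<lambda>t s'. wp q s' (\<lambda>t'. Q (t + t')))"
  unfolding wp_def by (blast intro: exec.Seq elim: exec_SeqE)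

lemma wp_Cond [simp]:
  "wp (Cond b p q) s Q \<longleftrightarrow>
    (if holds b s then wp p s (\<lambda>t. Q (1 + t)) else wp q s (\<lambda>t. Q (1 + t)))"
proof (cases "holds b s")
  case True
  then show ?thesis
    unfolding wp_def by (auto elim!: exec_CondE intro: exec.CondTrue[simplified])
next
  case False
  then show ?thesis
    unfolding wp_def by (auto elim!: exec_CondE intro: exec.CondFalse[simplified])
qed

text \<open>\<open>P k\<close> describes the state after \<open>k\<close> rounds. Each of the
  \<open>n\<close> rounds is charged one test and at most \<open>c\<close> steps; the last, failing
  test adds one.\<close>

lemma wp_While:
  assumes "\<And>k s. k < n \<Longrightarrow> P k s \<Longrightarrow> holds b s \<and> wp p s (\<lambda>t s'. t \<le> c \<and> P (Suc k) s')"
    and "\<And>s. P n s \<Longrightarrow> \<not> holds b s"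
    and "P 0 s"
  shows "wp (While b p) s (\<lambda>t s'. t \<le> Suc (n * Suc c) \<and> P n s')"
proof -
  \<comment> \<open>Starting from any round \<open>k\<close> allows induction on the number of
    remaining rounds.\<close>
  have "wp (While b p) s (\<lambda>t s'. t \<le> Suc ((n - k) * Suc c) \<and> P n s')"
    if "k \<le> n" "P k s" for k s
    using that
  proof (induction "n - k" arbitrary: k s)
    case 0
    then show ?case using assms(2) by (auto simp: wp_def intro!: exI exec.WhileFalse)
  next
    case (Suc l)
    then have "k < n" by simp
    then obtain t u where "holds b s" "exec p s t u" "t \<le> c" "P (Suc k) u"
      using assms(1) Suc.prems unfolding wp_def by blast
    moreover then obtain t' v where "exec (While b p) u t' v" "t' \<le> Suc (l * Suc c)" "P n v"
      using Suc.hyps(1)[of "Suc k" u] Suc.hyps(2) \<open>k < n\<close> unfolding wp_def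
      by (metis Suc_leI diff_Suc_Suc Suc_diff_Suc nat.inject)
    ultimately show ?case
      unfolding wp_def Suc.hyps(2)[symmetric]
      by (intro exI[of _ "1 + t + t'"] exI[of _ v]) (auto intro: exec.WhileTrue[simplified])
  qed
  from this[of 0] assms(3) show ?thesis by simp
qed

section \<open>The transformation program\<close>

text \<open>Registers 2 and 3 hold the constants 0 and 1; register 5 is the loop counter.\<close>

definition accumulate :: "nat \<Rightarrow> nat \<Rightarrow> prog" where
  "accumulate r q = Seq (RegConst r 0) (Seq (RegConst 5 0)
     (While (RegLess 5 0) (Seq (RegAdd r r q) (RegAdd 5 5 3))))"

text \<open>The machine cannot multiply, so the product is built by \<open>reg s 0\<close>
  additions. The register conditions keep loop bound, increment, counter and summand from being
  clobbered.\<close>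

lemma wp_accumulate:
  assumes "reg s 3 = 1" "r \<notin> {0, 3, 5, q}" "q \<noteq> 5"
  shows "wp (accumulate r q) s (\<lambda>t s'. t \<le> 3 * reg s 0 + 3 \<and>
    s' = s\<lparr>reg := (reg s)(r := reg s 0 * reg s q, 5 := reg s 0)\<rparr>)"
proof -
  define f where "f k = s\<lparr>reg := (reg s)(r := k * reg s q, 5 := k)\<rparr>" for k
  have "wp (While (RegLess 5 0) (Seq (RegAdd r r q) (RegAdd 5 5 3))) (f 0)
      (\<lambda>t s'. t \<le> Suc (reg s 0 * Suc 2) \<and> s' = f (reg s 0))"
    by (rule wp_While) (use assms in \<open>auto simp: f_def fun_eq_iff\<close>)
  then show ?thesis
    by (auto simp: accumulate_def f_def elim!: wp_mono)
qed

text \<open>Registers 4, 6, 7 and 8 hold the size of the block of an agent, the address of a scratch cell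
  behind the input, and the start and the end of the current block.\<close>

definition find_min :: prog where
  "find_min = While (RegLess 5 8)
     (Seq (Cond (MemLess 5 6) (MemCopy 6 5) Skip) (RegAdd 5 5 3))"

text \<open>The scratch cell holds the minimum of the part scanned so far. Its address is at least
  \<open>reg s 8\<close>, so updating it never disturbs the block.\<close>

lemma wp_find_min:
  assumes "reg s 3 = 1" "reg s 5 + B = reg s 8" "reg s 8 \<le> reg s 6" "B > 0"
    "mem s (reg s 6) = mem s (reg s 5)"
  shows "wp find_min s (\<lambda>t s'. t \<le> 4 * B + 1 \<and> s' = s\<lparr>reg := (reg s)(5 := reg s 8),
    mem := (mem s)(reg s 6 := Min (mem s ` {reg s 5..<reg s 8}))\<rparr>)"
proof -
  let ?b = "reg s 5"
  \<comment> \<open>Inserting the first value keeps the set nonempty at \<open>k = 0\<close> and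
    makes \<open>g 0\<close> the initial content of the scratch cell.\<close>
  define g where "g k = Min (insert (mem s ?b) (mem s ` {?b..<?b + k}))" for k
  define f where "f k = s\<lparr>reg := (reg s)(5 := ?b + k), mem := (mem s)(reg s 6 := g k)\<rparr>" for k
  have g_Suc: "g (Suc k) = min (mem s (?b + k)) (g k)" for k
    by (simp add: g_def atLeastLessThanSuc insert_commute[of "mem s ?b"])
  have "wp find_min (f 0) (\<lambda>t s'. t \<le> Suc (B * Suc 3) \<and> s' = f B)"
    unfolding find_min_def
    by (rule wp_While) (use assms in \<open>auto simp: f_def g_Suc fun_eq_iff min_def\<close>)
  moreover have "f 0 = s"
    by (simp add: f_def g_def flip: assms(5))
  moreover have "g B = Min (mem s ` {?b..<reg s 8})"
    using assms by (simp add: g_def insert_absorb)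
  ultimately show ?thesis
    using assms(2) by (auto simp: f_def elim!: wp_mono)
qed

definition compare_min :: prog where
  "compare_min = While (RegLess 7 8)
     (Seq (Cond (MemLess 6 7) (MemConst 7 1) (MemConst 7 0)) (RegAdd 7 7 3))"

text \<open>Overwriting in place is safe: each cell is compared before it is replaced, and the
  minimum sits outside the block.\<close>

lemma wp_compare_min:
  assumes "reg s 3 = 1" "reg s 7 + B = reg s 8" "reg s 8 \<le> reg s 6"
  shows "wp compare_min s (\<lambda>t s'. t \<le> 4 * B + 1 \<and> s' = s\<lparr>reg := (reg s)(7 := reg s 8),
    mem := (\<lambda>x. if x \<in> {reg s 7..<reg s 8} then of_bool (mem s (reg s 6) < mem s x)
      else mem s x)\<rparr>)"
proof -
  let ?b = "reg s 7"
  define f where "f k = s\<lparr>reg := (reg s)(7 := ?b + k),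
    mem := (\<lambda>x. if x \<in> {?b..<?b + k} then of_bool (mem s (reg s 6) < mem s x)
      else mem s x)\<rparr>" for k
  have "wp compare_min (f 0) (\<lambda>t s'. t \<le> Suc (B * Suc 3) \<and> s' = f B)"
    unfolding compare_min_def
    by (rule wp_While) (use assms in \<open>auto simp: f_def fun_eq_iff less_Suc_eq\<close>)
  then show ?thesis
    using assms(2) by (auto simp: f_def elim!: wp_mono)
qed

text \<open>Registers cannot be copied directly; adding register 2, which holds 0, does it. The
  \<open>MemCopy\<close> seeds the scratch cell with the first value of the block.\<close>

definition binarize_block :: prog where
  "binarize_block = Seq (MemCopy 6 7) (Seq (RegAdd 8 7 4) (Seq (RegAdd 5 7 2)
     (Seq find_min compare_min)))"

text \<open>Only cells below \<open>reg s 6\<close> are described, since the scratch cell itself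
  changes.\<close>

lemma wp_binarize_block:
  assumes "reg s 2 = 0" "reg s 3 = 1" "reg s 7 + reg s 4 \<le> reg s 6" "reg s 4 > 0"
  shows "wp binarize_block s (\<lambda>t s'. t \<le> 8 * reg s 4 + 5 \<and>
    reg s' = (reg s)(5 := reg s 7 + reg s 4, 8 := reg s 7 + reg s 4, 7 := reg s 7 + reg s 4) \<and>
    (\<forall>x<reg s 6. mem s' x = (if x \<in> {reg s 7..<reg s 7 + reg s 4}
      then of_bool (Min (mem s ` {reg s 7..<reg s 7 + reg s 4}) < mem s x) else mem s x)))"
proof -
  define u where "u = s\<lparr>mem := (mem s)(reg s 6 := mem s (reg s 7)),
    reg := (reg s)(8 := reg s 7 + reg s 4, 5 := reg s 7)\<rparr>"
  define v where "v = u\<lparr>reg := (reg u)(5 := reg u 8),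
    mem := (mem u)(reg u 6 := Min (mem u ` {reg u 5..<reg u 8}))\<rparr>"
  have find: "wp find_min u (\<lambda>t s'. t \<le> 4 * reg s 4 + 1 \<and> s' = v)"
    unfolding v_def by (rule wp_find_min) (use assms in \<open>auto simp: u_def\<close>)
  have comp: "wp compare_min v (\<lambda>t s'. t \<le> 4 * reg s 4 + 1 \<and> s' = v\<lparr>reg := (reg v)(7 := reg v 8),
    mem := (\<lambda>x. if x \<in> {reg v 7..<reg v 8} then of_bool (mem v (reg v 6) < mem v x)
      else mem v x)\<rparr>)"
    by (rule wp_compare_min) (use assms in \<open>auto simp: u_def v_def\<close>)
  have img: "mem u ` {reg s 7..<reg s 7 + reg s 4} = mem s ` {reg s 7..<reg s 7 + reg s 4}"
    using assms by (intro image_cong) (auto simp: u_def)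
  have "wp find_min u (\<lambda>t s'. wp compare_min s' (\<lambda>t'. \<lambda>s'. t + t' \<le> 8 * reg s 4 + 2 \<and>
      reg s' = (reg s)(5 := reg s 7 + reg s 4, 8 := reg s 7 + reg s 4, 7 := reg s 7 + reg s 4) \<and>
      (\<forall>x<reg s 6. mem s' x = (if x \<in> {reg s 7..<reg s 7 + reg s 4}
        then of_bool (Min (mem s ` {reg s 7..<reg s 7 + reg s 4}) < mem s x) else mem s x))))"
    using find
  proof (rule wp_mono, elim conjE, hypsubst)
    fix t :: nat assume t: "t \<le> 4 * reg s 4 + 1"
    show "wp compare_min v (\<lambda>t'. \<lambda>s'. t + t' \<le> 8 * reg s 4 + 2 \<and>
      reg s' = (reg s)(5 := reg s 7 + reg s 4, 8 := reg s 7 + reg s 4, 7 := reg s 7 + reg s 4) \<and>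
      (\<forall>x<reg s 6. mem s' x = (if x \<in> {reg s 7..<reg s 7 + reg s 4}
        then of_bool (Min (mem s ` {reg s 7..<reg s 7 + reg s 4}) < mem s x) else mem s x)))"
      using comp by (rule wp_mono) (use t img in \<open>auto simp: v_def u_def fun_eq_iff\<close>)
  qed
  then show ?thesis
    by (auto simp: binarize_block_def u_def assms fun_upd_twist elim!: wp_mono)
qed

text \<open>With \<open>n\<close> agents and \<open>m\<close> items, the accumulations give the
  block size \<open>n * m\<close> and then \<open>n * (n * m)\<close>, the first address behind the
  input, which serves both as scratch cell and as end mark of the loop.\<close>

definition binarize :: prog where
  "binarize = Seq (RegConst 2 0) (Cond (RegLess 2 1)
     (Seq (RegConst 3 1) (Seq (accumulate 4 1) (Seq (accumulate 6 4) (Seq (RegConst 7 0)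
       (While (RegLess 7 6) binarize_block))))) Skip)"

lemma wp_binarize:
  assumes "reg s 1 > 0"
  defines "n \<equiv> reg s 0" and "B \<equiv> reg s 0 * reg s 1"
  shows "wp binarize s (\<lambda>t s'. t \<le> 20 * (n * B) + 20 \<and> reg s' 0 = n \<and> reg s' 1 = reg s 1 \<and>
    (\<forall>i<n. \<forall>x\<in>{i * B..<i * B + B}.
      mem s' x = of_bool (Min (mem s ` {i * B..<i * B + B}) < mem s x)))"
proof -
  \<comment> \<open>Loop invariant: the first \<open>k\<close> blocks are binarized, while the later
    ones keep their original values, from which their minima are still to be computed.\<close>
  define P where "P k u \<longleftrightarrow> reg u 0 = n \<and> reg u 1 = reg s 1 \<and> reg u 2 = 0 \<and> reg u 3 = 1 \<and>
    reg u 4 = B \<and> reg u 6 = n * B \<and> reg u 7 = k * B \<and>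
    (\<forall>x\<in>{k * B..<n * B}. mem u x = mem s x) \<and>
    (\<forall>i<k. \<forall>x\<in>{i * B..<i * B + B}.
      mem u x = of_bool (Min (mem s ` {i * B..<i * B + B}) < mem s x))" for k and u :: state
  have le: "i * B + B \<le> k * B" if "i < k" for i k
    using mult_le_mono1[of "Suc i" k B] that by simp
  have step: "wp binarize_block u (\<lambda>t u'. t \<le> 8 * B + 5 \<and> P (Suc k) u')"
    if "k < n" "P k u" for k u
  proof -
    have B: "0 < B" using that(1) assms(1) by (simp add: B_def n_def)
    have img: "mem u ` {k * B..<k * B + B} = mem s ` {k * B..<k * B + B}"
      using that le[OF that(1)] by (intro image_cong) (auto simp: P_def)
    have "wp binarize_block u (\<lambda>t u'. t \<le> 8 * reg u 4 + 5 \<and>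
      reg u' = (reg u)(5 := reg u 7 + reg u 4, 8 := reg u 7 + reg u 4, 7 := reg u 7 + reg u 4) \<and>
      (\<forall>x<reg u 6. mem u' x = (if x \<in> {reg u 7..<reg u 7 + reg u 4}
        then of_bool (Min (mem u ` {reg u 7..<reg u 7 + reg u 4}) < mem u x) else mem u x)))"
      using that B le[OF that(1)] by (intro wp_binarize_block) (auto simp: P_def)
    then show ?thesis
    proof (rule wp_mono, elim conjE, intro conjI)
      fix t and u' :: state
      assume reg': "reg u' = (reg u)(5 := reg u 7 + reg u 4, 8 := reg u 7 + reg u 4,
          7 := reg u 7 + reg u 4)"
        and mem': "\<forall>x<reg u 6. mem u' x = (if x \<in> {reg u 7..<reg u 7 + reg u 4}
          then of_bool (Min (mem u ` {reg u 7..<reg u 7 + reg u 4}) < mem u x) else mem u x)"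
      have new: "mem u' x = (if x \<in> {k * B..<k * B + B}
          then of_bool (Min (mem s ` {k * B..<k * B + B}) < mem u x) else mem u x)"
        if "x < n * B" for x
        using mem' that \<open>P k u\<close> by (simp add: P_def img)
      have "mem u' x = of_bool (Min (mem s ` {i * B..<i * B + B}) < mem s x)"
        if "i < Suc k" "x \<in> {i * B..<i * B + B}" for i x
      proof (cases "i = k")
        case True
        then show ?thesis using that new[of x] le[OF \<open>k < n\<close>] \<open>P k u\<close> by (simp add: P_def)
      next
        case False
        then have "i < k" using that by simp
        then show ?thesis
          using that new[of x] le[OF \<open>k < n\<close>] le[OF \<open>i < k\<close>] \<open>P k u\<close> by (simp add: P_def)
      qed
      moreover have "mem u' x = mem s x" if "x \<in> {Suc k * B..<n * B}" for x
        using that new[of x] \<open>P k u\<close> by (simp add: P_def)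
      ultimately show "P (Suc k) u'"
        using reg' \<open>P k u\<close> by (simp add: P_def)
    qed (use that in \<open>simp add: P_def\<close>)
  qed
  \<comment> \<open>The states during initialization: after the constants, after each accumulation,
    and after resetting register 7.\<close>
  define u where "u = s\<lparr>reg := (reg s)(2 := 0, 3 := 1)\<rparr>"
  define v where "v = u\<lparr>reg := (reg u)(4 := reg u 0 * reg u 1, 5 := reg u 0)\<rparr>"
  define w where "w = v\<lparr>reg := (reg v)(6 := reg v 0 * reg v 4, 5 := reg v 0)\<rparr>"
  define z where "z = w\<lparr>reg := (reg w)(7 := 0)\<rparr>"
  have loop: "wp (While (RegLess 7 6) binarize_block) z
      (\<lambda>t s'. t \<le> Suc (n * Suc (8 * B + 5)) \<and> P n s')"
  proof (rule wp_While)
    fix k u assume "k < n" "P k u"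
    moreover have "0 < B" using \<open>k < n\<close> assms(1) by (simp add: B_def n_def)
    ultimately show "holds (RegLess 7 6) u \<and>
        wp binarize_block u (\<lambda>t u'. t \<le> 8 * B + 5 \<and> P (Suc k) u')"
      using step by (simp add: P_def)
  qed (auto simp: P_def z_def w_def v_def u_def B_def n_def)
  \<comment> \<open>There is an item, so terms linear in \<open>n\<close> are absorbed: the total is
    at most \<open>8 * (n * B) + 12 * n + 11\<close>, whence the factor 20.\<close>
  have n: "n \<le> n * B"
    by (cases "n = 0") (use assms(1) in \<open>simp_all add: B_def n_def\<close>)
  then have time: "3 + (t1 + (t2 + Suc t3)) \<le> 20 * (n * B) + 20"
    if "t1 \<le> 3 * n + 3" "t2 \<le> 3 * n + 3" "t3 \<le> Suc (n * Suc (8 * B + 5))" for t1 t2 t3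
  proof -
    have "t3 \<le> 8 * (n * B) + 6 * n + 1"
      using that(3) by (simp add: algebra_simps)
    with that(1,2) n show ?thesis by linarith
  qed
  have "wp (accumulate 4 1) u (\<lambda>t s'. t \<le> 3 * n + 3 \<and> s' = v)"
    unfolding v_def using wp_accumulate[of u 4 1] by (simp add: u_def n_def)
  then have "wp (accumulate 4 1) u (\<lambda>t1 s'. wp (accumulate 6 4) s' (\<lambda>t2 s'.
      wp (While (RegLess 7 6) binarize_block) (s'\<lparr>reg := (reg s')(7 := 0)\<rparr>)
        (\<lambda>t3 s'. 3 + (t1 + (t2 + Suc t3)) \<le> 20 * (n * B) + 20 \<and> P n s')))"
  proof (rule wp_mono, elim conjE, hypsubst)
    fix t1 assume t1: "t1 \<le> 3 * n + 3"
    have "wp (accumulate 6 4) v (\<lambda>t s'. t \<le> 3 * n + 3 \<and> s' = w)"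
      unfolding w_def using wp_accumulate[of v 6 4] by (simp add: u_def v_def n_def)
    then show "wp (accumulate 6 4) v (\<lambda>t2 s'.
        wp (While (RegLess 7 6) binarize_block) (s'\<lparr>reg := (reg s')(7 := 0)\<rparr>)
          (\<lambda>t3 s'. 3 + (t1 + (t2 + Suc t3)) \<le> 20 * (n * B) + 20 \<and> P n s'))"
    proof (rule wp_mono, elim conjE, hypsubst)
      fix t2 assume t2: "t2 \<le> 3 * n + 3"
      from loop show "wp (While (RegLess 7 6) binarize_block) (w\<lparr>reg := (reg w)(7 := 0)\<rparr>)
          (\<lambda>t3 s'. 3 + (t1 + (t2 + Suc t3)) \<le> 20 * (n * B) + 20 \<and> P n s')"
        unfolding z_def by (rule wp_mono) (use time[OF t1 t2] in blast)
    qed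
  qed
  then show ?thesis
    using assms(1) by (simp add: binarize_def u_def P_def) (auto elim!: wp_mono)
qed

text \<open>For \<open>m = 0\<close> the input has constant size, so the program must not loop over the agents.\<close>

lemma wp_binarize_no_items:
  assumes "reg s 1 = 0"
  shows "wp binarize s (\<lambda>t s'. t \<le> 3 \<and> reg s' 0 = reg s 0 \<and> reg s' 1 = reg s 1)"
  using assms by (simp add: binarize_def)

section \<open>Memory blocks of agents and the choice of the scaling factor\<close>

lemma cell_block:
  assumes "i \<in> agents I"
  defines "B \<equiv> num_agents I * num_items I"
  shows "{(i - 1) * B..<(i - 1) * B + B} = (\<lambda>(j, a). cell I i j a) ` (agents I \<times> items I)"
    (is "?L = ?R")
proof
  let ?n = "num_agents I" and ?m = "num_items I"
  show "?R \<subseteq> ?L"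
  proof clarify
    fix j a assume ja: "j \<in> agents I" "a \<in> items I"
    have "(j - 1) * ?m + (a - 1) < Suc (j - 1) * ?m"
      using ja by (auto simp: items_def)
    also have "\<dots> \<le> B"
      unfolding B_def using ja by (intro mult_le_mono1) (auto simp: agents_def)
    finally show "cell I i j a \<in> ?L"
      by (auto simp: cell_def B_def algebra_simps)
  qed
  show "?L \<subseteq> ?R"
  proof
    fix x assume x: "x \<in> ?L"
    \<comment> \<open>The offset inside the block is split by division by
      \<open>num_items I\<close>: quotient and remainder are \<open>j - 1\<close> and
      \<open>a - 1\<close>.\<close>
    define r where "r = x - (i - 1) * B"
    have r: "r < ?n * ?m" "x = (i - 1) * B + r"
      using x by (auto simp: r_def B_def)
    then have m: "?m > 0" by (cases ?m) auto
    have "r div ?m < ?n" "r mod ?m < ?m"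
      using r m by (auto simp: less_mult_imp_div_less)
    then have "Suc (r div ?m) \<in> agents I" "Suc (r mod ?m) \<in> items I"
      by (auto simp: agents_def items_def)
    moreover have "x = cell I i (Suc (r div ?m)) (Suc (r mod ?m))"
      using r by (simp add: cell_def B_def algebra_simps)
    ultimately show "x \<in> ?R" by (auto intro!: rev_image_eqI)
  qed
qed

text \<open>Among at most two values, one above the minimum always exceeds it by the same amount, so
  the valuation is the minimum plus a positive multiple of the indicator.\<close>

lemma equivalent_inst_indicator_above_Min:
  assumes "two_valued I"
    and "num_agents I' = num_agents I" "num_items I' = num_items I"
    and val': "\<And>i j a. \<lbrakk>i \<in> agents I; j \<in> agents I; a \<in> items I\<rbrakk> \<Longrightarrow> val I' i j a =
      of_bool (Min ((\<lambda>(j, a). val I i j a) ` (agents I \<times> items I)) < val I i j a)"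
  shows "equivalent_inst \<phi> I I'"
proof (rule equivalent_inst_affine)
  fix i assume i: "i \<in> agents I"
  define W where "W = (\<lambda>(j, a). val I i j a) ` (agents I \<times> items I)"
  obtain x y where xy: "\<forall>j\<in>agents I. \<forall>a\<in>items I. val I i j a \<in> {x, y}"
    using bspec[OF assms(1)[unfolded two_valued_def] i] by (elim exE)
  have W: "W \<subseteq> {x, y}"
    unfolding W_def by (rule image_subsetI) (use xy in \<open>simp add: split_beta mem_Times_iff\<close>)
  have fin: "finite W" by (simp add: W_def agents_def items_def)
  \<comment> \<open>If \<open>x = y\<close>, the indicator is always 0 and any positive factor will
    do; \<open>\<bar>x - y\<bar>\<close> would vanish.\<close>
  define d where "d = (if x = y then 1 else \<bar>x - y\<bar>)"
  have "val I i j a = Min W + d * val I' i j a" if ja: "j \<in> agents I" "a \<in> items I" for j a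
  proof -
    have v: "val I i j a \<in> W"
      unfolding W_def using ja by (intro rev_image_eqI[of "(j, a)"]) simp_all
    \<comment> \<open>Membership \<open>v\<close> shows that \<open>W\<close> is nonempty, so
      \<open>Min W\<close> is one of its elements.\<close>
    have min: "Min W \<in> {x, y}" "val I i j a \<in> {x, y}"
      using W v Min_in[OF fin] by blast+
    have "val I' i j a = of_bool (Min W < val I i j a)"
      using val'[OF i ja] unfolding W_def .
    with min Min_le[OF fin v] show ?thesis
      unfolding d_def by (elim insertE emptyE) simp_all
  qed
  moreover have "d > 0" by (simp add: d_def)
  ultimately show "\<exists>y d. d > 0 \<and>
      (\<forall>j\<in>agents I. \<forall>a\<in>items I. val I i j a = y + d * val I' i j a)"
    by blast
qed (rule assms(2), rule assms(3))

text \<open>Program and constant are chosen independently of \<phi>: one transformation serves all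
  three notions.\<close>

theorem proposition4p1:
  fixes \<phi> :: fairness
  shows "\<exists>(p :: prog) (c :: nat). \<forall>(I :: inst) (s :: state).
    two_valued I \<and> represents s I \<longrightarrow>
      (\<exists>(t :: nat) (s' :: state) (I' :: inst).
         exec p s t s' \<and> t \<le> c * input_size I \<and> represents s' I' \<and>
         num_agents I' = num_agents I \<and> num_items I' = num_items I \<and>
         binary I' \<and> equivalent_inst \<phi> I I')"
proof (rule exI[of _ binarize], rule exI[of _ 20], intro allI impI, elim conjE)
  fix I s assume two: "two_valued I" and rep: "represents s I"
  define n where "n = num_agents I"
  define m where "m = num_items I"
  define B where "B = n * m"
  have regs: "reg s 0 = n" "reg s 1 = m"
    using rep by (simp_all add: represents_def n_def m_def)
  \<comment> \<open>Without items no cell belongs to the representation, so the memory claim is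
    restricted to \<open>m > 0\<close>.\<close>
  have "\<exists>t s'. exec binarize s t s' \<and> t \<le> 20 * input_size I \<and> reg s' 0 = n \<and> reg s' 1 = m \<and>
    (m > 0 \<longrightarrow> (\<forall>i<n. \<forall>x\<in>{i * B..<i * B + B}.
      mem s' x = of_bool (Min (mem s ` {i * B..<i * B + B}) < mem s x)))"
  proof (cases "m = 0")
    case True
    obtain t s' where "exec binarize s t s'" "t \<le> 3" "reg s' 0 = n" "reg s' 1 = m"
      using wp_binarize_no_items[of s] regs True unfolding wp_def by auto
    then show ?thesis
      using True by (intro exI[of _ t] exI[of _ s']) (simp add: input_size_def)
  next
    case False
    then obtain t s' where "exec binarize s t s'" "t \<le> 20 * (n * B) + 20" "reg s' 0 = n"
      "reg s' 1 = m" "\<forall>i<n. \<forall>x\<in>{i * B..<i * B + B}.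
        mem s' x = of_bool (Min (mem s ` {i * B..<i * B + B}) < mem s x)"
      using wp_binarize[of s] regs unfolding wp_def B_def by auto
    moreover have "20 * (n * B) + 20 \<le> 20 * input_size I"
      by (simp add: input_size_def B_def n_def m_def mult.assoc)
    ultimately show ?thesis by (intro exI[of _ t] exI[of _ s']) simp
  qed
  then obtain t s' where run: "exec binarize s t s'" "t \<le> 20 * input_size I"
    and regs': "reg s' 0 = n" "reg s' 1 = m"
    and mem': "m > 0 \<longrightarrow> (\<forall>i<n. \<forall>x\<in>{i * B..<i * B + B}.
      mem s' x = of_bool (Min (mem s ` {i * B..<i * B + B}) < mem s x))"
    by (elim exE conjE)
  \<comment> \<open>Reading \<open>I'\<close> off the final memory makes
    \<open>represents s' I'\<close> immediate; the work lies in \<open>val'\<close>.\<close>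
  define I' where "I' = I\<lparr>val := (\<lambda>i j a. mem s' (cell I i j a))\<rparr>"
  have eq: "num_agents I' = num_agents I" "num_items I' = num_items I"
    by (simp_all add: I'_def)
  have val': "val I' i j a =
      of_bool (Min ((\<lambda>(j, a). val I i j a) ` (agents I \<times> items I)) < val I i j a)"
    if ija: "i \<in> agents I" "j \<in> agents I" "a \<in> items I" for i j a
  proof -
    have block: "{(i - 1) * B..<(i - 1) * B + B} = (\<lambda>(j, a). cell I i j a) ` (agents I \<times> items I)"
      using cell_block[OF ija(1)] by (simp add: B_def n_def m_def)
    have "mem s ` {(i - 1) * B..<(i - 1) * B + B} = (\<lambda>(j, a). val I i j a) ` (agents I \<times> items I)"
      unfolding block image_image using rep ija(1)
      by (intro image_cong) (auto simp: represents_def)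
    moreover have "mem s (cell I i j a) = val I i j a"
      using rep ija by (simp add: represents_def)
    moreover have "cell I i j a \<in> {(i - 1) * B..<(i - 1) * B + B}"
      unfolding block using ija by auto
    \<comment> \<open>Agents are numbered from 1 and blocks from 0; the item \<open>a\<close>
      witnesses \<open>m > 0\<close>.\<close>
    moreover have "m > 0" "i - 1 < n"
      using ija by (auto simp: agents_def items_def m_def n_def)
    ultimately show ?thesis
      using mem'[rule_format, of "i - 1" "cell I i j a"] by (simp add: I'_def)
  qed
  have "represents s' I'"
    using regs' by (simp add: represents_def I'_def cell_def n_def m_def)
  moreover have "binary I'"
    using val' eq by (auto simp: binary_def agents_def items_def)
  moreover have "equivalent_inst \<phi> I I'"
    using equivalent_inst_indicator_above_Min[OF two eq val'] by blast
  ultimately show "\<exists>t s' I'. exec binarize s t s' \<and> t \<le> 20 * input_size I \<and>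
      represents s' I' \<and> num_agents I' = num_agents I \<and> num_items I' = num_items I \<and>
      binary I' \<and> equivalent_inst \<phi> I I'"
    using run eq by blast
qed

end
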